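(* Let $\kappa$ be either $\omega$ or a measurable cardinal. For any $\kappa$-complete (uniform) ultrafilter $U$ over $\kappa$, $(U,\supseteq^* )\equiv_T([2^\kappa]^{<\kappa},\subseteq)$ if and only if $\neg\mathrm{Gal}^*(U,\kappa,2^\kappa)$.
   Context: For $X,Y\subseteq\kappa$, $X\subseteq^*Y$ means $X\setminus Y$ is bounded in $\kappa$; $(U,\supseteq^* )$ is $U$ ordered by $A\le B$ iff $B\subseteq^* A$. For directed posets, $P\le_T Q$ means there is a map $P\to Q$ sending unbounded subsets to unbounded subsets; $P\equiv_T Q$ means both $P\le_T Q$ and $Q\le_T P$. $[2^\kappa]^{<\kappa}$ is the set of subsets of $2^\kappa$ of size $<\kappa$ ordered by inclusion. For an ultrafilter $U$ over $\kappa$ and cardinals $\mu\le\lambda$, $\mathrm{Gal}^*(U,\mu,\lambda)$ means: for every sequence $\langle A_i\mid i<\lambda\rangle$ of (distinct) members of $U$ there is $I\subseteq\lambda$ with $|I|=\mu$ such that $\langle A_i\mid i\in I\rangle$ has a pseudointersection in $U$, i.e. some $X\in U$ with $X\subseteq^*A_i$ for all $i\in I$. *)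

theory Defs
  imports Main
begin

unbundle cardinal_syntax

text \<open>
  A cardinal \<open>\<kappa>\<close> is a relation with \<open>Card_order \<kappa>\<close>, i.e. an initial well-order; its
  underlying set of ordinals is \<open>Field \<kappa>\<close>, and \<open>(a, b) \<in> \<kappa>\<close> is the (reflexive) order.
\<close>

definition bounded_in :: "'a rel \<Rightarrow> 'a set \<Rightarrow> bool" where
  "bounded_in \<kappa> Z \<longleftrightarrow> (\<exists>b \<in> Field \<kappa>. \<forall>z \<in> Z. (z, b) \<in> \<kappa>)"

definition subset_star :: "'a rel \<Rightarrow> 'a set \<Rightarrow> 'a set \<Rightarrow> bool" where
  "subset_star \<kappa> X Y \<longleftrightarrow> bounded_in \<kappa> (X - Y)"

definition supset_star :: "'a rel \<Rightarrow> 'a set \<Rightarrow> 'a set \<Rightarrow> bool" where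
  "supset_star \<kappa> A B \<longleftrightarrow> subset_star \<kappa> B A"

definition ultrafilter_over :: "'a set \<Rightarrow> 'a set set \<Rightarrow> bool" where
  "ultrafilter_over S U \<longleftrightarrow>
     U \<subseteq> Pow S \<and> S \<in> U \<and> {} \<notin> U \<and>
     (\<forall>X \<in> U. \<forall>Y. X \<subseteq> Y \<and> Y \<subseteq> S \<longrightarrow> Y \<in> U) \<and>
     (\<forall>X \<in> U. \<forall>Y \<in> U. X \<inter> Y \<in> U) \<and>
     (\<forall>X. X \<subseteq> S \<longrightarrow> X \<in> U \<or> S - X \<in> U)"

definition complete_filter :: "'k rel \<Rightarrow> 'a set set \<Rightarrow> bool" where
  "complete_filter \<kappa> U \<longleftrightarrow> (\<forall>F. F \<subseteq> U \<and> F \<noteq> {} \<and> |F| <o \<kappa> \<longrightarrow> \<Inter>F \<in> U)"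

definition nonprincipal_over :: "'a set \<Rightarrow> 'a set set \<Rightarrow> bool" where
  "nonprincipal_over S U \<longleftrightarrow> (\<forall>x \<in> S. {x} \<notin> U)"

definition uniform_filter :: "'a rel \<Rightarrow> 'a set set \<Rightarrow> bool" where
  "uniform_filter \<kappa> U \<longleftrightarrow> (\<forall>X \<in> U. |X| =o \<kappa>)"

definition measurable_cardinal :: "'a rel \<Rightarrow> bool" where
  "measurable_cardinal \<kappa> \<longleftrightarrow>
     Card_order \<kappa> \<and> natLeq <o \<kappa> \<and>
     (\<exists>U. ultrafilter_over (Field \<kappa>) U \<and> complete_filter \<kappa> U \<and> nonprincipal_over (Field \<kappa>) U)"

text \<open>Orders are given by a carrier set and a relation on it.\<close>

definition unbounded_subset :: "'p set \<Rightarrow> ('p \<Rightarrow> 'p \<Rightarrow> bool) \<Rightarrow> 'p set \<Rightarrow> bool" where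
  "unbounded_subset P le X \<longleftrightarrow> X \<subseteq> P \<and> \<not> (\<exists>b \<in> P. \<forall>x \<in> X. le x b)"

definition tukey_le ::
  "'p set \<Rightarrow> ('p \<Rightarrow> 'p \<Rightarrow> bool) \<Rightarrow> 'q set \<Rightarrow> ('q \<Rightarrow> 'q \<Rightarrow> bool) \<Rightarrow> bool" where
  "tukey_le P leP Q leQ \<longleftrightarrow>
     (\<exists>f. f ` P \<subseteq> Q \<and> (\<forall>X. unbounded_subset P leP X \<longrightarrow> unbounded_subset Q leQ (f ` X)))"

definition tukey_equiv ::
  "'p set \<Rightarrow> ('p \<Rightarrow> 'p \<Rightarrow> bool) \<Rightarrow> 'q set \<Rightarrow> ('q \<Rightarrow> 'q \<Rightarrow> bool) \<Rightarrow> bool" where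
  "tukey_equiv P leP Q leQ \<longleftrightarrow> tukey_le P leP Q leQ \<and> tukey_le Q leQ P leP"

definition small_subsets :: "'i rel \<Rightarrow> 'k rel \<Rightarrow> 'i set set" where
  "small_subsets \<nu> \<kappa> = {S. S \<subseteq> Field \<nu> \<and> |S| <o \<kappa>}"

text \<open>The cardinal \<open>\<kappa>\<close> enters \<open>Gal_star\<close> only through the relation \<open>subset_star \<kappa>\<close>.\<close>

definition Gal_star :: "'a rel \<Rightarrow> 'a set set \<Rightarrow> 'm rel \<Rightarrow> 'i rel \<Rightarrow> bool" where
  "Gal_star \<kappa> U \<mu> \<nu> \<longleftrightarrow>
     (\<forall>A. A ` Field \<nu> \<subseteq> U \<and> inj_on A (Field \<nu>) \<longrightarrow>
        (\<exists>I. I \<subseteq> Field \<nu> \<and> |I| =o \<mu> \<and> (\<exists>X \<in> U. \<forall>i \<in> I. subset_star \<kappa> X (A i))))"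

end

theory Submission
  imports Defs
begin

text \<open>
  Every \<open>\<kappa>\<close>-directed order of size at most \<open>2\<^sup>\<kappa>\<close> is Tukey below \<open>[2\<^sup>\<kappa>]\<^sup><\<^sup>\<kappa>\<close>, by sending points to
  singletons, so only the reduction \<open>[2\<^sup>\<kappa>]\<^sup><\<^sup>\<kappa> \<le>\<^sub>T U\<close> matters. A witness \<open>A\<close> for the failure of
  \<open>Gal\<^sup>*\<close> gives the reduction sending \<open>S\<close> to the intersection of the \<open>A\<^sub>i\<close> with \<open>i \<in> S\<close>. Conversely,
  a reduction restricted to singletons has fibres of size below \<open>\<kappa>\<close>, hence \<open>2\<^sup>\<kappa>\<close> many values, and
  no \<open>\<kappa>\<close> many of these values have a common pseudointersection in \<open>U\<close>.
\<close>

lemma not_card_of_ordLess_iff: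
  assumes "Card_order \<kappa>"
  shows "\<not> |X| <o \<kappa> \<longleftrightarrow> \<kappa> \<le>o |X|"
  using assms card_of_Well_order card_order_on_well_order_on by (intro not_ordLess_iff_ordLeq) blast+

lemma infinite_Field_if_natLeq_ordLeq:
  assumes "Card_order \<kappa>" and "natLeq \<le>o \<kappa>"
  shows "infinite (Field \<kappa>)"
  using ordLeq_ordIso_trans[OF assms(2) ordIso_symmetric[OF card_of_Field_ordIso[OF assms(1)]]]
  using infinite_iff_natLeq_ordLeq by blast

lemma card_of_singleton_ordLess:
  assumes "natLeq \<le>o \<kappa>"
  shows "|{y}| <o \<kappa>"
  using iffD1[OF finite_iff_ordLess_natLeq, of "{y}"] assms by (blast intro: ordLess_ordLeq_trans)

text \<open>Every upper bound contains \<open>\<Union>X\<close>, so \<open>X\<close> is bounded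
  exactly when \<open>\<Union>X\<close> is itself small enough to be a member.\<close>

lemma unbounded_small_subsets_iff:
  assumes "Card_order \<kappa>" and "X \<subseteq> small_subsets \<nu> \<kappa>"
  shows "unbounded_subset (small_subsets \<nu> \<kappa>) (\<subseteq>) X \<longleftrightarrow> \<kappa> \<le>o |\<Union>X|"
proof -
  have "(\<exists>b \<in> small_subsets \<nu> \<kappa>. \<forall>x \<in> X. x \<subseteq> b) \<longleftrightarrow> |\<Union>X| <o \<kappa>"
  proof
    assume "\<exists>b \<in> small_subsets \<nu> \<kappa>. \<forall>x \<in> X. x \<subseteq> b"
    then obtain b where b: "|b| <o \<kappa>" "\<Union>X \<subseteq> b"
      by (auto simp: small_subsets_def)
    show "|\<Union>X| <o \<kappa>"
      using card_of_mono1[OF b(2)] b(1) by (rule ordLeq_ordLess_trans)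
  next
    assume "|\<Union>X| <o \<kappa>"
    with assms(2) have "\<Union>X \<in> small_subsets \<nu> \<kappa>"
      by (auto simp: small_subsets_def)
    then show "\<exists>b \<in> small_subsets \<nu> \<kappa>. \<forall>x \<in> X. x \<subseteq> b"
      by blast
  qed
  moreover have "\<not> |\<Union>X| <o \<kappa> \<longleftrightarrow> \<kappa> \<le>o |\<Union>X|"
    using assms(1) by (simp add: not_card_of_ordLess_iff)
  ultimately show ?thesis
    using assms(2) by (simp add: unbounded_subset_def)
qed

text \<open>By directedness an unbounded set has at least \<open>\<kappa>\<close> elements. Sending
  points injectively to singletons keeps the union of the image that large.\<close>

lemma tukey_le_small_subsets:
  assumes "Card_order \<kappa>" and "natLeq \<le>o \<kappa>" and "|P| \<le>o |Field \<nu>|"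
    and directed: "\<And>X. X \<subseteq> P \<Longrightarrow> |X| <o \<kappa> \<Longrightarrow> \<exists>b \<in> P. \<forall>x \<in> X. le x b"
  shows "tukey_le P le (small_subsets \<nu> \<kappa>) (\<subseteq>)"
proof -
  obtain g where g: "inj_on g P" "g ` P \<subseteq> Field \<nu>"
    using assms(3) card_of_ordLeq[of P "Field \<nu>"] by auto
  have into: "(\<lambda>x. {g x}) ` P \<subseteq> small_subsets \<nu> \<kappa>"
    using g(2) card_of_singleton_ordLess[OF assms(2)] by (auto simp: small_subsets_def)
  have "unbounded_subset (small_subsets \<nu> \<kappa>) (\<subseteq>) ((\<lambda>x. {g x}) ` X)"
    if "unbounded_subset P le X" for X
  proof -
    have X: "X \<subseteq> P" "\<not> |X| <o \<kappa>"
      using that directed unfolding unbounded_subset_def by blast+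
    have "\<kappa> \<le>o |X|"
      using X(2) assms(1) by (simp add: not_card_of_ordLess_iff)
    also have "|X| =o |g ` X|"
      using g(1) X(1) by (meson card_of_ordIso inj_on_imp_bij_betw inj_on_subset)
    also have "g ` X = \<Union>((\<lambda>x. {g x}) ` X)"
      by auto
    finally show ?thesis
      using X(1) into assms(1) by (subst unbounded_small_subsets_iff) auto
  qed
  with into show ?thesis
    unfolding tukey_le_def by blast
qed

text \<open>\<open>F\<close> is the union of its fibres, each of size at most
  \<open>\<kappa>\<close>. An image of size at most \<open>\<kappa>\<close> would force the same
  bound on \<open>F\<close>; a larger image absorbs the fibres, so it is as large as their
  union.\<close>

lemma card_of_image_of_small_fibres:
  assumes "Card_order \<kappa>" and "natLeq \<le>o \<kappa>" and "\<kappa> <o |F|"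
    and fibres: "\<And>m. m \<in> A ` F \<Longrightarrow> |{i \<in> F. A i = m}| <o \<kappa>"
  shows "|A ` F| =o |F|"
proof -
  have eq: "|Field \<kappa>| =o \<kappa>"
    using assms(1) by (rule card_of_Field_ordIso)
  have inf: "infinite (Field \<kappa>)"
    using assms(1,2) by (rule infinite_Field_if_natLeq_ordLeq)
  have fib: "|{i \<in> F. A i = m}| \<le>o |Field \<kappa>|" if "m \<in> A ` F" for m
    using fibres[OF that] eq ordLess_imp_ordLeq ordIso_symmetric ordLeq_ordIso_trans by blast
  have F: "(\<Union>m \<in> A ` F. {i \<in> F. A i = m}) = F"
    by auto
  have "|F| \<le>o |A ` F|"
  proof (cases "|A ` F| \<le>o |Field \<kappa>|")
    case True
    then have "|F| \<le>o |Field \<kappa>|"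
      using card_of_UNION_ordLeq_infinite[OF inf True, of "\<lambda>m. {i \<in> F. A i = m}"] fib unfolding F by blast
    then have "|F| \<le>o \<kappa>"
      using eq by (rule ordLeq_ordIso_trans)
    with assms(3) show ?thesis
      using not_ordLess_ordLeq by blast
  next
    case False
    then have le: "|Field \<kappa>| \<le>o |A ` F|"
      using ordLeq_total[of "|Field \<kappa>|" "|A ` F|"] by (simp add: card_of_Well_order)
    then have "infinite (A ` F)"
      using inf card_of_ordLeq_infinite by blast
    then show ?thesis
      using card_of_UNION_ordLeq_infinite[of "A ` F" "A ` F" "\<lambda>m. {i \<in> F. A i = m}"]
        ordLeq_transitive[OF fib le] unfolding F by (blast intro: ordIso_imp_ordLeq card_of_refl)
  qed
  then show ?thesis
    using card_of_image by (simp add: ordIso_iff_ordLeq)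
qed

lemma not_Gal_star_if_tukey_le:
  assumes "Card_order \<kappa>" and "natLeq \<le>o \<kappa>" and "\<kappa> <o |Field \<nu>|"
    and "tukey_le (small_subsets \<nu> \<kappa>) (\<subseteq>) U (supset_star \<kappa>)"
  shows "\<not> Gal_star \<kappa> U \<kappa> \<nu>"
proof
  assume gal: "Gal_star \<kappa> U \<kappa> \<nu>"
  obtain f where f: "f ` small_subsets \<nu> \<kappa> \<subseteq> U"
    and unb: "\<And>X. unbounded_subset (small_subsets \<nu> \<kappa>) (\<subseteq>) X \<Longrightarrow>
      unbounded_subset U (supset_star \<kappa>) (f ` X)"
    using assms(4) unfolding tukey_le_def by blast
  define A where "A i = f {i}" for i
  have single: "{i} \<in> small_subsets \<nu> \<kappa>" if "i \<in> Field \<nu>" for i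
    using that card_of_singleton_ordLess[OF assms(2)] by (auto simp: small_subsets_def)
  have AU: "A ` Field \<nu> \<subseteq> U"
    using f single by (auto simp: A_def)
  \<comment> \<open>Any \<open>\<kappa>\<close> singletons are unbounded, hence so are their values.
    Allowing \<open>I\<close> of size at least \<open>\<kappa>\<close> makes this apply to fibres of
    \<open>A\<close>, whose exact size is unknown.\<close>
  have no_pseudo: "\<not> (\<exists>X \<in> U. \<forall>i \<in> I. subset_star \<kappa> X (A i))"
    if I: "I \<subseteq> Field \<nu>" "\<kappa> \<le>o |I|" for I
  proof -
    have "\<Union>((\<lambda>i. {i}) ` I) = I"
      by auto
    then have "unbounded_subset (small_subsets \<nu> \<kappa>) (\<subseteq>) ((\<lambda>i. {i}) ` I)"
      using unbounded_small_subsets_iff[OF assms(1), of "(\<lambda>i. {i}) ` I"] I single by auto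
    from unb[OF this] show ?thesis
      by (auto simp: unbounded_subset_def supset_star_def A_def)
  qed
  \<comment> \<open>On a fibre of size at least \<open>\<kappa>\<close> the common value
    \<open>m\<close> would be its own pseudointersection.\<close>
  have "|{i \<in> Field \<nu>. A i = m}| <o \<kappa>" if "m \<in> A ` Field \<nu>" for m
  proof (rule ccontr)
    assume "\<not> |{i \<in> Field \<nu>. A i = m}| <o \<kappa>"
    then have "\<kappa> \<le>o |{i \<in> Field \<nu>. A i = m}|"
      using assms(1) by (simp add: not_card_of_ordLess_iff)
    moreover have "subset_star \<kappa> m m"
    proof -
      have "Field \<kappa> \<noteq> {}"
        using infinite_Field_if_natLeq_ordLeq[OF assms(1,2)] by auto
      then show ?thesis
        by (auto simp: subset_star_def bounded_in_def)
    qed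
    then have "\<forall>i \<in> {i \<in> Field \<nu>. A i = m}. subset_star \<kappa> m (A i)"
      by simp
    moreover have "m \<in> U"
      using AU that by blast
    ultimately show False
      using no_pseudo[of "{i \<in> Field \<nu>. A i = m}"] by blast
  qed
  then have "|Field \<nu>| =o |A ` Field \<nu>|"
    using card_of_image_of_small_fibres[OF assms(1-3), of A] ordIso_symmetric by blast
  \<comment> \<open>\<open>Gal_star\<close> speaks of injective sequences only, while
    \<open>A\<close> may repeat values; \<open>h\<close> lists the range of \<open>A\<close> without
    repetition over the same index set.\<close>
  then obtain h where h: "bij_betw h (Field \<nu>) (A ` Field \<nu>)"
    using card_of_ordIso by blast
  then have "h ` Field \<nu> \<subseteq> U" "inj_on h (Field \<nu>)"
    using AU by (auto simp: bij_betw_def)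
  then obtain I X where I: "I \<subseteq> Field \<nu>" "|I| =o \<kappa>" and X: "X \<in> U" "\<forall>i \<in> I. subset_star \<kappa> X (h i)"
    using gal[unfolded Gal_star_def, THEN spec[of _ h]] by auto
  \<comment> \<open>\<open>j\<close> carries indices for \<open>h\<close> back to indices for
    \<open>A\<close>, where \<open>no_pseudo\<close> applies; injectivity of \<open>h\<close> keeps
    the number of indices.\<close>
  define j where "j i = inv_into (Field \<nu>) A (h i)" for i
  have hA: "h i \<in> A ` Field \<nu>" if "i \<in> I" for i
    using that I(1) h by (auto simp: bij_betw_def)
  have j: "j i \<in> Field \<nu>" "A (j i) = h i" if "i \<in> I" for i
    using hA[OF that] by (auto simp: j_def inv_into_into f_inv_into_f)
  have "inj_on j I"
    using j(2) I(1) h by (metis bij_betw_def inj_on_def subsetD)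
  then have "|I| =o |j ` I|"
    by (meson card_of_ordIso inj_on_imp_bij_betw)
  then have "\<kappa> \<le>o |j ` I|"
    using I(2) by (meson ordIso_iff_ordLeq ordLeq_transitive)
  moreover have "j ` I \<subseteq> Field \<nu>" "\<forall>i \<in> j ` I. subset_star \<kappa> X (A i)"
    using j X(2) by auto
  ultimately show False
    using no_pseudo[of "j ` I"] X(1) by blast
qed

text \<open>A bound of the intersections over all \<open>T \<in> X\<close> is a pseudointersection
  of every \<open>A i\<close> with \<open>i \<in> \<Union>X\<close>, and an unbounded
  \<open>X\<close> has a union of size at least \<open>\<kappa>\<close>.\<close>

lemma tukey_le_if_not_Gal_star:
  assumes "Card_order \<kappa>" and "ultrafilter_over S U" and "complete_filter \<kappa> U"
    and "\<not> Gal_star \<kappa> U \<kappa> \<nu>"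
  shows "tukey_le (small_subsets \<nu> \<kappa>) (\<subseteq>) U (supset_star \<kappa>)"
proof -
  obtain A where A: "A ` Field \<nu> \<subseteq> U"
    and no_pseudo:
      "\<not> (\<exists>I. I \<subseteq> Field \<nu> \<and> |I| =o \<kappa> \<and> (\<exists>X \<in> U. \<forall>i \<in> I. subset_star \<kappa> X (A i)))"
    using assms(4) unfolding Gal_star_def not_all not_imp by (elim exE conjE)
  \<comment> \<open>The empty intersection would be \<open>UNIV\<close>, which can lie outside
    \<open>U\<close>, so the empty set is sent to \<open>S\<close>.\<close>
  define f where "f T = (if T = {} then S else \<Inter>(A ` T))" for T
  have f: "f T \<in> U" if "T \<in> small_subsets \<nu> \<kappa>" for T
  proof (cases "T = {}")
    case True
    then show ?thesis
      using assms(2) by (simp add: f_def ultrafilter_over_def)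
  next
    case False
    have T: "T \<subseteq> Field \<nu>" "|T| <o \<kappa>"
      using that by (auto simp: small_subsets_def)
    have "|A ` T| <o \<kappa>"
      using card_of_image T(2) by (rule ordLeq_ordLess_trans)
    moreover have "A ` T \<subseteq> U"
      using T(1) A by blast
    ultimately show ?thesis
      using False assms(3) by (simp add: f_def complete_filter_def)
  qed
  have "unbounded_subset U (supset_star \<kappa>) (f ` X)"
    if unb: "unbounded_subset (small_subsets \<nu> \<kappa>) (\<subseteq>) X" for X
  proof -
    have X: "X \<subseteq> small_subsets \<nu> \<kappa>"
      using unb by (simp add: unbounded_subset_def)
    then have "\<kappa> \<le>o |\<Union>X|"
      using unb assms(1) unbounded_small_subsets_iff by blast
    \<comment> \<open>\<open>Gal_star\<close> asks for exactly \<open>\<kappa>\<close> indices, so a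
      copy of \<open>Field \<kappa>\<close> is cut out of \<open>\<Union>X\<close>.\<close>
    then have "|Field \<kappa>| \<le>o |\<Union>X|"
      using card_of_Field_ordIso[OF assms(1)] ordIso_ordLeq_trans by blast
    then obtain g where g: "inj_on g (Field \<kappa>)" "g ` Field \<kappa> \<subseteq> \<Union>X"
      using card_of_ordLeq[of "Field \<kappa>" "\<Union>X"] by auto
    define I where "I = g ` Field \<kappa>"
    have "|Field \<kappa>| =o |I|"
      using g(1) unfolding I_def by (meson card_of_ordIso inj_on_imp_bij_betw)
    then have card_I: "|I| =o \<kappa>"
      using card_of_Field_ordIso[OF assms(1)] ordIso_symmetric ordIso_transitive by blast
    have I: "I \<subseteq> Field \<nu>"
      using g(2) X by (auto simp: I_def small_subsets_def)
    have False if B: "B \<in> U" "\<forall>T \<in> X. supset_star \<kappa> (f T) B" for B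
    proof -
      obtain i where i: "i \<in> I" "\<not> subset_star \<kappa> B (A i)"
        using no_pseudo I card_I B(1) by blast
      then obtain T where T: "T \<in> X" "i \<in> T"
        using g(2) by (auto simp: I_def)
      \<comment> \<open>Since \<open>f T \<subseteq> A i\<close>, a bound for \<open>B - f T\<close>
        also bounds \<open>B - A i\<close>.\<close>
      then have "B - A i \<subseteq> B - f T"
        by (auto simp: f_def)
      moreover have "bounded_in \<kappa> (B - f T)"
        using B(2) T(1) by (simp add: supset_star_def subset_star_def)
      ultimately show False
        using i(2) unfolding subset_star_def bounded_in_def by (meson subsetD)
    qed
    then have "\<not> (\<exists>B \<in> U. \<forall>Y \<in> f ` X. supset_star \<kappa> Y B)"
      by blast
    moreover have "f ` X \<subseteq> U"
      using X f by blast
    ultimately show ?thesis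
      by (simp add: unbounded_subset_def)
  qed
  with f show ?thesis
    unfolding tukey_le_def by blast
qed

text \<open>The intersection of a nonempty \<open>X\<close> is a bound, with all differences empty;
  a nonempty \<open>Field \<kappa>\<close> supplies the point that \<open>bounded_in\<close> demands
  even for the empty set.\<close>

lemma complete_ultrafilter_directed:
  assumes "Field \<kappa> \<noteq> {}" and "ultrafilter_over S U" and "complete_filter \<kappa> U"
    and "X \<subseteq> U" and "|X| <o \<kappa>"
  shows "\<exists>b \<in> U. \<forall>x \<in> X. supset_star \<kappa> x b"
proof (cases "X = {}")
  case True
  then show ?thesis
    using assms(2) by (auto simp: ultrafilter_over_def)
next
  case False
  then have "\<Inter>X \<in> U"
    using assms(3-5) by (simp add: complete_filter_def)
  moreover have "supset_star \<kappa> x (\<Inter>X)" if "x \<in> X" for x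
    using that assms(1) by (auto simp: supset_star_def subset_star_def bounded_in_def)
  ultimately show ?thesis
    by blast
qed

theorem theorem3p16:
  fixes \<kappa> :: "'a rel" and U :: "'a set set"
  assumes "Card_order \<kappa>"
    and "\<kappa> =o natLeq \<or> measurable_cardinal \<kappa>"
    and "ultrafilter_over (Field \<kappa>) U"
    and "complete_filter \<kappa> U"
    and "uniform_filter \<kappa> U"
  shows "tukey_equiv U (supset_star \<kappa>) (small_subsets (ctwo ^c \<kappa>) \<kappa>) (\<subseteq>)
     \<longleftrightarrow> \<not> Gal_star \<kappa> U \<kappa> (ctwo ^c \<kappa>)"
proof -
  have inf: "natLeq \<le>o \<kappa>"
    using assms(2) by (auto simp: measurable_cardinal_def ordLess_imp_ordLeq
        intro: ordIso_imp_ordLeq ordIso_symmetric)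
  have ne: "Field \<kappa> \<noteq> {}"
    using infinite_Field_if_natLeq_ordLeq[OF assms(1) inf] by auto
  have card_field: "|Field (ctwo ^c \<kappa>)| =o ctwo ^c \<kappa>"
    by (rule card_of_Field_ordIso[OF Card_order_cexp])
  have less: "\<kappa> <o |Field (ctwo ^c \<kappa>)|"
    using ordLess_ctwo_cexp[OF assms(1)] card_field ordIso_symmetric ordLess_ordIso_trans by blast
  have "|U| \<le>o |Pow (Field \<kappa>)|"
    using assms(3) by (auto simp: ultrafilter_over_def intro: card_of_mono1)
  \<comment> \<open>\<open>ctwo ^c \<kappa>\<close> unfolds to the cardinal of the functions from
    \<open>Field \<kappa>\<close> to the booleans, that is, of characteristic functions.\<close>
  also have "|Pow (Field \<kappa>)| =o |Field (ctwo ^c \<kappa>)|"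
    using card_of_Pow_Func[of "Field \<kappa>"]
    by (simp add: cexp_def ctwo_def Field_card_of)
  finally have "tukey_le U (supset_star \<kappa>) (small_subsets (ctwo ^c \<kappa>) \<kappa>) (\<subseteq>)"
    using complete_ultrafilter_directed[OF ne assms(3,4)]
    by (intro tukey_le_small_subsets assms(1) inf)
  then show ?thesis
    using not_Gal_star_if_tukey_le[OF assms(1) inf less]
      tukey_le_if_not_Gal_star[OF assms(1,3,4)]
    unfolding tukey_equiv_def by blast
qed

end
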